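(* Let $p$ be an odd prime. Then $$C^{\rm e}_{\rm u}(p)=C_{\rm sd}(p).$$
   Context: All graphs are simple (no loops, no multiple edges or arcs). An undirected edge is identified with the pair of oppositely directed arcs, so undirected graphs are regarded as symmetric digraphs. A circulant of order $n$ is a digraph on the vertex set $\mathbb{Z}_n=\{0,1,\dots,n-1\}$ invariant under the cyclic permutation $v\mapsto v+1 \pmod n$; it is regular. For odd $n$, $C^{\rm e}_{\rm u}(n)$ denotes the number of isomorphism classes of undirected circulants of order $n$ of even semi-valency, that is, whose valency (degree) is congruent to $0$ modulo $4$. The complement of a digraph has the same vertices and, for distinct $u,v$, the arc $(u,v)$ exactly when the original does not; a digraph is self-complementary if it is isomorphic to its complement. $C_{\rm sd}(n)$ is the number of isomorphism classes of self-complementary directed circulants of order $n$ (symmetric ones included). *)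

theory Defs
  imports "Graph_Theory.Graph_Theory" "HOL-Computational_Algebra.Primes"
begin

text \<open>
  Simple digraphs are the \<^locale>\<open>pair_digraph\<close>s: finite, no parallel arcs, no loops.
  An undirected edge is a pair of opposite arcs, so undirected means \<^const>\<open>symmetric\<close>.
  The vertices of \<open>\<int>\<^sub>n\<close> are the residues \<open>0, \<dots>, n - 1\<close>.
\<close>

definition cyclic_shift :: "nat \<Rightarrow> nat \<Rightarrow> nat" where
  "cyclic_shift n v = (v + 1) mod n"

definition circulant :: "nat \<Rightarrow> nat pair_pre_digraph \<Rightarrow> bool" where
  "circulant n G \<longleftrightarrow> pair_digraph G \<and> pverts G = {0..<n} \<and>
     map_prod (cyclic_shift n) (cyclic_shift n) ` parcs G = parcs G"

definition complement :: "'a pair_pre_digraph \<Rightarrow> 'a pair_pre_digraph" where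
  "complement G = \<lparr> pverts = pverts G,
     parcs = {(u, v). u \<in> pverts G \<and> v \<in> pverts G \<and> u \<noteq> v \<and> (u, v) \<notin> parcs G} \<rparr>"

definition self_complementary :: "'a pair_pre_digraph \<Rightarrow> bool" where
  "self_complementary G \<longleftrightarrow> digraph_iso (with_proj G) (with_proj (complement G))"

text \<open>
  Isomorphism is that of arbitrary digraphs; it need not come from an automorphism
  of the group \<open>\<int>\<^sub>n\<close>.
\<close>

definition iso_rel :: "'a pair_pre_digraph set \<Rightarrow> ('a pair_pre_digraph \<times> 'a pair_pre_digraph) set" where
  "iso_rel A = {(G, H). G \<in> A \<and> H \<in> A \<and> digraph_iso (with_proj G) (with_proj H)}"

definition num_iso_classes :: "'a pair_pre_digraph set \<Rightarrow> nat" where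
  "num_iso_classes A = card (A // iso_rel A)"

text \<open>
  The semi-valency of an undirected circulant of odd order is half its (even) valency,
  so it is even iff the valency is divisible by 4. In a symmetric digraph the valency
  of a vertex is its out-degree.
\<close>

definition C_u_even :: "nat \<Rightarrow> nat" where
  "C_u_even n = num_iso_classes {G. circulant n G \<and> symmetric (with_proj G) \<and>
     (\<forall>v \<in> pverts G. out_degree (with_proj G) v mod 4 = 0)}"

definition C_sd :: "nat \<Rightarrow> nat" where
  "C_sd n = num_iso_classes {G. circulant n G \<and> self_complementary G}"

lemma digraph_iso_refl:
  assumes "pair_wf_digraph G"
  shows "digraph_iso (with_proj G) (with_proj G)"
proof -
  let ?f = "\<lparr>iso_verts = id, iso_arcs = id, iso_head = snd, iso_tail = fst\<rparr>"
  have "pre_digraph.digraph_isomorphism (with_proj G) ?f"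
    using assms by (simp add: pre_digraph.digraph_isomorphism_def wf_digraph_wp_iff)
  moreover have "with_proj G = app_iso ?f (with_proj G)"
    by (simp add: app_iso_def with_proj_def)
  ultimately show ?thesis unfolding digraph_iso_def by blast
qed

lemma equiv_iso_rel:
  assumes "\<And>G. G \<in> A \<Longrightarrow> pair_wf_digraph G"
  shows "equiv A (iso_rel A)"
proof (rule equivI)
  show "iso_rel A \<subseteq> A \<times> A" by (auto simp: iso_rel_def)
  show "refl_on A (iso_rel A)"
    using assms by (auto simp: iso_rel_def intro!: refl_onI digraph_iso_refl)
  show "sym (iso_rel A)"
    using assms by (auto simp: iso_rel_def wf_digraph_wp_iff intro!: symI digraph_iso_swap)
  show "trans (iso_rel A)"
    by (auto simp: iso_rel_def intro!: transI intro: digraph_iso_trans)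
qed

lemma finite_circulants: "finite {G. circulant n G}"
proof (rule finite_subset)
  show "{G. circulant n G} \<subseteq>
      (\<lambda>E. \<lparr>pverts = {0..<n}, parcs = E\<rparr>) ` Pow ({0..<n} \<times> {0..<n})"
  proof
    fix G assume "G \<in> {G. circulant n G}"
    then interpret pair_digraph G by (simp add: circulant_def)
    have "parcs G \<subseteq> pverts G \<times> pverts G"
      using wellformed' by auto
    then show "G \<in> (\<lambda>E. \<lparr>pverts = {0..<n}, parcs = E\<rparr>) ` Pow ({0..<n} \<times> {0..<n})"
      using \<open>G \<in> _\<close> by (intro image_eqI[of _ _ "parcs G"]) (auto simp: circulant_def)
  qed
qed simp

end

theory Submission
  imports Defs "HOL-Combinatorics.Permutations" "HOL-Number_Theory.Residue_Primitive_Roots"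
begin

text \<open>
  Fix a primitive root \<open>g\<close> modulo \<open>p\<close> and write \<open>p - 1 = 2 m\<close>. Recording which powers of \<open>g\<close>
  lie in the connection set turns circulants of order \<open>p\<close> into binary words of period \<open>2 m\<close>.
  Multiplying the connection set by \<open>g\<close> shifts the word, complementing the graph negates the
  word, and, as \<open>g ^ m\<close> is \<open>-1\<close>, the graph is undirected iff the word has period \<open>m\<close>. The
  valency is the number of ones in a window of length \<open>2 m\<close>.

  Two circulants of prime order are isomorphic only if a multiplier \<open>x \<mapsto> a x\<close> carries one to
  the other (\<open>prime_circulant_iso_multiplier\<close>). Let \<open>I\<close> be the set of isomorphisms fixing \<open>0\<close>.
  It is a coset of a group of permutations of \<open>p - 1\<close> points, so \<open>card I\<close> divides \<open>(p - 1)!\<close> and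
  is prime to \<open>p\<close>. The group \<open>\<int>\<^sub>p\<close> acts on \<open>I\<close>, with \<open>k\<close> sending \<open>f\<close> to
  \<open>x \<mapsto> f (x + k) - f k\<close>; hence some \<open>k \<noteq> 0\<close> fixes some \<open>f\<close>, which means
  \<open>f (x + k) = f x + f k\<close> for all \<open>x\<close>, and such an \<open>f\<close> is a multiplier.

  Both numbers are therefore numbers of shift orbits of words, and a Burnside count
  (\<open>twisted_burnside\<close>) reduces their equality to the following. For each \<open>k\<close> let \<open>E k\<close> be the
  number of words of period \<open>m\<close> and weight divisible by 4 that are fixed by the shift by \<open>k\<close>,
  and \<open>D k\<close> the number of words of period \<open>2 m\<close> that this shift negates. Then
  \<open>2 E k = D k + D (k + m)\<close> (\<open>fixed_words_balance\<close>). Indeed, let \<open>d = gcd k m\<close> and let \<open>w = 2 ^ d\<close> be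
  the number of words of period \<open>d\<close>. If \<open>m / d\<close> is even, the three numbers are all \<open>w\<close>; if it is
  odd, then \<open>E k = w / 2\<close>, while one of \<open>D k\<close> and \<open>D (k + m)\<close> is \<open>w\<close> and the other is \<open>0\<close>.
\<close>

unbundle no m_inv_syntax

section \<open>Counting the orbits of a cyclic group\<close>

definition orbit_rel :: "(nat \<Rightarrow> 'a \<Rightarrow> 'a) \<Rightarrow> 'a set \<Rightarrow> ('a \<times> 'a) set" where
  "orbit_rel act X = {(x, y). x \<in> X \<and> y \<in> X \<and> (\<exists>k. y = act k x)}"

text \<open>
  An action of \<open>\<int>\<^sub>n\<close>, with the exponents kept as natural numbers so that no reduction modulo
  \<open>n\<close> is needed when exponents are added.
\<close>

locale cyclic_action =
  fixes n :: nat and act :: "nat \<Rightarrow> 'a \<Rightarrow> 'a" and X :: "'a set"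
  assumes n_pos: "n > 0"
    and finite_X: "finite X"
    and act_closed: "x \<in> X \<Longrightarrow> act k x \<in> X"
    and act_act: "x \<in> X \<Longrightarrow> act j (act k x) = act (j + k) x"
    and act_0: "x \<in> X \<Longrightarrow> act 0 x = x"
    and act_n: "x \<in> X \<Longrightarrow> act n x = x"
begin

lemma act_mult_n: "x \<in> X \<Longrightarrow> act (k + n * q) x = act k x"
proof (induction q)
  case (Suc q)
  have "act (k + n * Suc q) x = act (k + n * q) (act n x)"
    using Suc.prems by (simp add: act_act algebra_simps)
  then show ?case using Suc by (simp add: act_n)
qed simp

lemma act_mod: "x \<in> X \<Longrightarrow> act (k mod n) x = act k x"
  using act_mult_n[of x "k mod n" "k div n"] by simp

lemma act_cancel:
  assumes "x \<in> X" shows "act (i + j) x = act (i + k) x \<longleftrightarrow> act j x = act k x"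
proof
  have inv: "act (n * i - i) (act (i + l) x) = act l x" for l
  proof -
    have "n * i - i + (i + l) = l + n * i" using n_pos by simp
    then show ?thesis using assms by (simp only: act_act act_mult_n)
  qed
  assume "act (i + j) x = act (i + k) x"
  then show "act j x = act k x" using inv by metis
next
  assume "act j x = act k x"
  then show "act (i + j) x = act (i + k) x" using assms by (metis act_act)
qed

lemma equiv_orbit_rel: "equiv X (orbit_rel act X)"
proof (rule equivI)
  show "orbit_rel act X \<subseteq> X \<times> X" by (auto simp: orbit_rel_def)
  show "refl_on X (orbit_rel act X)"
    by (auto simp: orbit_rel_def intro!: refl_onI) (metis act_0)
  show "sym (orbit_rel act X)"
  proof (rule symI)
    fix x y assume "(x, y) \<in> orbit_rel act X"
    then obtain k where k: "x \<in> X" "y \<in> X" "y = act k x" by (auto simp: orbit_rel_def)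
    have "n * k - k + k = 0 + n * k" using n_pos by simp
    then have "act (n * k - k) y = x"
      using k by (simp only: act_act act_mult_n act_0)
    then show "(y, x) \<in> orbit_rel act X" using k unfolding orbit_rel_def by blast
  qed
  show "trans (orbit_rel act X)"
    by (auto simp: orbit_rel_def act_act intro!: transI)
qed

text \<open>
  Both sets are cosets of the stabilizer of \<open>x\<close>, and translating the exponents modulo \<open>n\<close> carries
  one to the other.
\<close>

lemma card_transporter:
  assumes "x \<in> X"
  shows "card {k \<in> {..<n}. act k x = act i x} = card {k \<in> {..<n}. act k x = act j x}"
proof -
  have le: "card {k \<in> {..<n}. act k x = act i x} \<le> card {k \<in> {..<n}. act k x = act j x}" for i j
  proof (rule card_inj_on_le)
    \<comment> \<open>An exponent congruent to \<open>j - i\<close> modulo \<open>n\<close>; adding \<open>n * i\<close> keeps it a natural number.\<close>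
    define d where "d = j + n * i - i"
    have d: "d + i = j + n * i"
      unfolding d_def using n_pos by (simp add: trans_le_add2)
    show "inj_on (\<lambda>k. (d + k) mod n) {k \<in> {..<n}. act k x = act i x}"
    proof (rule inj_onI)
      fix a b assume ab: "a \<in> {k \<in> {..<n}. act k x = act i x}" "b \<in> {k \<in> {..<n}. act k x = act i x}"
        and "(d + a) mod n = (d + b) mod n"
      then have "[a = b] (mod n)" by (simp add: cong_def[symmetric] cong_add_lcancel_nat)
      then show "a = b" using ab by (simp add: cong_less_modulus_unique_nat)
    qed
    show "(\<lambda>k. (d + k) mod n) ` {k \<in> {..<n}. act k x = act i x} \<subseteq> {k \<in> {..<n}. act k x = act j x}"
    proof (clarsimp simp: act_mod assms n_pos)
      fix k assume "act k x = act i x"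
      then have "act (d + k) x = act (d + i) x" using assms by (simp add: act_cancel)
      then show "act (d + k) x = act j x" using assms by (simp add: d act_mult_n)
    qed
  qed simp
  show ?thesis by (rule antisym) (rule le)+
qed

text \<open>
  For \<open>c = id\<close> this is Burnside's lemma. A map \<open>c\<close> that commutes with the action and preserves each
  orbit acts on the orbit \<open>Q\<close> of \<open>x\<close> like some \<open>act j\<close>; so the exponents taking \<open>y\<close> to \<open>c y\<close> are as
  numerous as those taking \<open>x\<close> to \<open>y\<close>, and over all \<open>y\<close> in \<open>Q\<close> they add up to \<open>n\<close>. For
  self-complementary words, \<open>c\<close> will be negation.
\<close>

theorem twisted_burnside:
  assumes c_orbit: "\<And>x. x \<in> X \<Longrightarrow> \<exists>j. c x = act j x"
    and c_act: "\<And>x k. x \<in> X \<Longrightarrow> c (act k x) = act k (c x)"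
  shows "n * card (X // orbit_rel act X) = (\<Sum>k<n. card {x \<in> X. act k x = c x})"
proof -
  let ?R = "orbit_rel act X"
  have orbit_sum: "(\<Sum>y\<in>Q. card {k \<in> {..<n}. act k y = c y}) = n" if "Q \<in> X // ?R" for Q
  proof -
    from that obtain x where x: "x \<in> X" "Q = ?R `` {x}" by (auto simp: quotient_def)
    obtain j where j: "c x = act j x" using c_orbit[OF x(1)] by blast
    have "card {k \<in> {..<n}. act k y = c y} = card {k \<in> {..<n}. act k x = y}" if "y \<in> Q" for y
    proof -
      from that x obtain i where i: "y = act i x" by (auto simp: orbit_rel_def)
      have "act k y = c y \<longleftrightarrow> act k x = act j x" for k
        using x i j by (simp add: c_act act_act add.commute[of k] act_cancel)
      then show ?thesis using card_transporter[OF x(1), of j i] i by simp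
    qed
    then have "(\<Sum>y\<in>Q. card {k \<in> {..<n}. act k y = c y}) = (\<Sum>y\<in>Q. \<Sum>k | k \<in> {..<n} \<and> act k x = y. 1)"
      by (intro sum.cong) simp_all
    also have "\<dots> = (\<Sum>k<n. 1)"
    proof (rule sum.group)
      show "finite Q" using x finite_X by (auto simp: orbit_rel_def elim!: finite_subset[rotated])
      show "(\<lambda>k. act k x) ` {..<n} \<subseteq> Q" using x by (auto simp: orbit_rel_def act_closed)
    qed simp
    finally show ?thesis by simp
  qed
  have "(\<Sum>k<n. card {x \<in> X. act k x = c x}) = (\<Sum>k<n. \<Sum>x | x \<in> X \<and> act k x = c x. 1)"
    by simp
  also have "\<dots> = (\<Sum>x\<in>X. \<Sum>k | k \<in> {..<n} \<and> act k x = c x. 1)"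
    by (rule sum.swap_restrict) (simp_all add: finite_X)
  also have "\<dots> = (\<Sum>x\<in>\<Union>(X // ?R). card {k \<in> {..<n}. act k x = c x})"
    using equiv_orbit_rel by (simp add: Union_quotient)
  also have "\<dots> = (\<Sum>Q\<in>X // ?R. \<Sum>x\<in>Q. card {k \<in> {..<n}. act k x = c x})"
  proof (subst sum.Union_disjoint)
    have "\<forall>Q\<in>X // ?R. Q \<subseteq> X" using equiv_orbit_rel by (metis Union_quotient Union_upper)
    then show "\<forall>Q\<in>X // ?R. finite Q" using finite_X finite_subset by blast
    show "\<forall>A\<in>X // ?R. \<forall>B\<in>X // ?R. A \<noteq> B \<longrightarrow> A \<inter> B = {}"
      using quotient_disj[OF equiv_orbit_rel] by blast
  qed simp
  also have "\<dots> = n * card (X // ?R)" using orbit_sum by simp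
  finally show ?thesis by simp
qed

end

section \<open>Periodic binary words\<close>

definition shift :: "nat \<Rightarrow> (nat \<Rightarrow> bool) \<Rightarrow> nat \<Rightarrow> bool" where
  "shift k T i = T (i + k)"

definition words :: "nat \<Rightarrow> (nat \<Rightarrow> bool) set" where
  "words n = {T. shift n T = T}"

definition weight :: "nat \<Rightarrow> (nat \<Rightarrow> bool) \<Rightarrow> nat" where
  "weight n T = card {i. i < n \<and> T i}"

lemma words_iff: "T \<in> words n \<longleftrightarrow> (\<forall>i. T (i + n) = T i)"
  by (simp add: words_def shift_def fun_eq_iff)

lemma shift_shift: "shift j (shift k T) = shift (j + k) T"
  by (simp add: shift_def fun_eq_iff add.assoc)

lemma shift_0: "shift 0 T = T"
  by (simp add: shift_def fun_eq_iff)

lemma shift_compl: "shift k (- T) = - shift k T"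
  by (simp add: shift_def fun_eq_iff)

lemma words_add_mult: "T \<in> words n \<Longrightarrow> T (i + n * q) = T i"
proof (induction q)
  case (Suc q)
  then have "T (i + n * q + n) = T i" by (simp add: words_iff)
  then show ?case by (simp add: algebra_simps)
qed simp

lemma words_mono: "d dvd n \<Longrightarrow> words d \<subseteq> words n"
  unfolding words_iff[of _ n] subset_iff by (metis dvdE words_add_mult)

lemma words_cong:
  assumes T: "T \<in> words n" and ij: "[i = j] (mod n)" shows "T i = T j"
proof -
  have "T i = T (i mod n)" for i using words_add_mult[OF T, of "i mod n" "i div n"] by simp
  from this[of i] this[of j] show ?thesis using ij by (simp add: cong_def)
qed

lemma words_shift: "T \<in> words n \<Longrightarrow> shift k T \<in> words n"
  by (simp add: words_def shift_shift) (metis add.commute shift_shift)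

lemma words_compl: "T \<in> words n \<Longrightarrow> - T \<in> words n"
  by (simp add: words_iff)

text \<open>
  Bezout: if \<open>a x = b y + gcd a b\<close>, a shift by \<open>gcd a b\<close> has the same effect as one by \<open>a x\<close>.
\<close>

lemma words_gcd: "words a \<inter> words b = words (gcd a b)"
proof
  show "words (gcd a b) \<subseteq> words a \<inter> words b" by (simp add: words_mono)
  show "words a \<inter> words b \<subseteq> words (gcd a b)"
  proof (cases "a = 0")
    case False
    then obtain x y where xy: "a * x = b * y + gcd a b" using bezout_nat by blast
    show ?thesis
    proof (intro subsetI, elim IntE)
      fix T assume T: "T \<in> words a" "T \<in> words b"
      have "T (i + gcd a b) = T i" for i
      proof -
        have "T (i + gcd a b) = T (i + gcd a b + b * y)" using words_add_mult[OF T(2)] by simp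
        also have "i + gcd a b + b * y = i + a * x" using xy by simp
        also have "T (i + a * x) = T i" by (rule words_add_mult[OF T(1)])
        finally show ?thesis .
      qed
      then show "T \<in> words (gcd a b)" by (simp add: words_iff)
    qed
  qed simp
qed

lemma finite_words: assumes "n > 0" shows "finite (words n)"
proof (rule finite_imageD)
  let ?f = "\<lambda>T::nat \<Rightarrow> bool. {i. i < n \<and> T i}"
  show "finite (?f ` words n)" by (rule finite_subset[of _ "Pow {..<n}"]) auto
  show "inj_on ?f (words n)"
  proof (rule inj_onI, rule ext)
    fix S T i assume ST: "S \<in> words n" "T \<in> words n" and eq: "?f S = ?f T"
    have "S i = S (i mod n)" "T i = T (i mod n)"
      by (rule words_cong[OF ST(1)] words_cong[OF ST(2)], simp add: cong_def)+
    moreover have "i mod n < n" using assms by simp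
    ultimately show "S i = T i" using eq by auto
  qed
qed

lemma weight_mult: 
  assumes T: "T \<in> words d" shows "weight (q * d) T = q * weight d T"
proof (induction q)
  case (Suc q)
  have "{i. i < Suc q * d \<and> T i} = {i. i < q * d \<and> T i} \<union> (\<lambda>i. i + q * d) ` {i. i < d \<and> T i}"
  proof -
    have "T (i + q * d) = T i" for i using words_add_mult[OF T, of i q] by (simp add: mult.commute)
    moreover have "x \<in> (\<lambda>i. i + q * d) ` {i. i < d \<and> T i}"
      if "\<not> x < q * d" "x < Suc q * d" "T x" for x
    proof (rule image_eqI)
      show "x = (x - q * d) + q * d" using that by simp
      show "x - q * d \<in> {i. i < d \<and> T i}" using that calculation[of "x - q * d"] by simp
    qed
    ultimately show ?thesis by auto
  qed
  moreover have "{i. i < q * d \<and> T i} \<inter> (\<lambda>i. i + q * d) ` {i. i < d \<and> T i} = {}" by auto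
  ultimately have "weight (Suc q * d) T = weight (q * d) T + weight d T"
    unfolding weight_def by (simp add: card_Un_disjoint card_image)
  then show ?case using Suc by simp
qed (simp add: weight_def)

text \<open>
  Flipping the bits at the multiples of \<open>d\<close> changes exactly one bit per period, hence the parity
  of the weight.
\<close>

lemma card_even_words:
  assumes "d > 0"
  shows "2 * card {T \<in> words d. even (weight d T)} = card (words d)"
proof -
  let ?E = "{T \<in> words d. even (weight d T)}" and ?O = "{T \<in> words d. odd (weight d T)}"
  define tog where "tog T = (\<lambda>i. T i \<noteq> (d dvd i))" for T :: "nat \<Rightarrow> bool"
  have tog_tog: "tog (tog T) = T" for T by (auto simp: tog_def)
  have tog_words: "tog T \<in> words d" if "T \<in> words d" for T
    using that by (simp add: words_iff tog_def)
  have w: "even (weight d (tog T)) \<longleftrightarrow> odd (weight d T)" for T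
  proof -
    let ?B = "{i. 0 < i \<and> i < d \<and> T i}"
    have "weight d S = card ?B + (if S 0 then 1 else 0)" if "\<And>i. 0 < i \<Longrightarrow> i < d \<Longrightarrow> S i = T i" for S
    proof -
      have "{i. i < d \<and> S i} = (if S 0 then insert 0 ?B else ?B)"
        using that assms by (auto, (metis gr0I)+)
      then show ?thesis by (simp add: weight_def)
    qed
    from this[of T] this[of "tog T"] show ?thesis
      by (simp add: tog_def nat_dvd_not_less)
  qed
  have "bij_betw tog ?E ?O"
    by (rule bij_betw_byWitness[where f' = tog]) (auto simp: tog_tog tog_words w)
  then have "card ?E = card ?O" by (rule bij_betw_same_card)
  moreover have "card (words d) = card ?E + card ?O"
    using finite_words[OF assms] by (subst card_Un_disjoint[symmetric]) (auto intro: arg_cong[where f = card])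
  ultimately show ?thesis by simp
qed

definition even_words :: "nat \<Rightarrow> (nat \<Rightarrow> bool) set" where
  "even_words m = {T \<in> words m. weight (2 * m) T mod 4 = 0}"

definition sc_words :: "nat \<Rightarrow> (nat \<Rightarrow> bool) set" where
  "sc_words n = {T \<in> words n. \<exists>k. shift k T = - T}"

text \<open>
  Being fixed by the shifts by \<open>k\<close> and by \<open>m\<close> means having period \<open>d\<close>. A window of length \<open>2 m\<close>
  consists of \<open>2 (m / d)\<close> periods, so the condition on the weight is vacuous for even \<open>m / d\<close> and
  selects half of the words otherwise.
\<close>

lemma card_even_words_fixed:
  assumes m: "m > 0" and d: "d = gcd k m"
  shows "2 * card {T \<in> even_words m. shift k T = T} = (if even (m div d) then 2 else 1) * card (words d)"
proof -
  have "d > 0" "d dvd m" using m d by auto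
  have "{T \<in> even_words m. shift k T = T} = {T \<in> words k \<inter> words m. weight (2 * m) T mod 4 = 0}"
    by (auto simp: even_words_def words_def)
  also have "\<dots> = {T \<in> words d. weight (2 * m) T mod 4 = 0}"
    by (simp add: d words_gcd)
  also have "\<dots> = {T \<in> words d. even (m div d) \<or> even (weight d T)}"
  proof (rule Collect_cong, rule conj_cong[OF refl])
    fix T assume "T \<in> words d"
    from weight_mult[OF this, of "2 * (m div d)"] \<open>d dvd m\<close>
    have "weight (2 * m) T = 2 * ((m div d) * weight d T)" by (simp add: mult.assoc)
    then have "weight (2 * m) T mod 4 = 0 \<longleftrightarrow> even ((m div d) * weight d T)" by presburger
    then show "weight (2 * m) T mod 4 = 0 \<longleftrightarrow> even (m div d) \<or> even (weight d T)" by simp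
  qed
  finally show ?thesis using card_even_words[OF \<open>d > 0\<close>] by simp
qed

text \<open>
  The words negated by the shift form a torsor, under pointwise exclusive or, over those fixed
  by it, and the latter are the words of period \<open>gcd k (2 m) = d\<close>. The alternating word \<open>A\<close> with
  blocks of length \<open>d\<close> is one negated word: the shift moves it by the odd number \<open>k / d\<close> of blocks.
\<close>

lemma card_sc_words_fixed_odd:
  assumes m: "m > 0" and d: "d = gcd k m" and odd: "odd (k div d)"
  shows "card {T \<in> words (2 * m). shift k T = - T} = card (words d)"
proof -
  have "d > 0" "d dvd m" "d dvd k" using m d by auto
  define A where "A i \<longleftrightarrow> odd (i div d)" for i
  have A_k: "A (i + k) \<longleftrightarrow> \<not> A i" for i
    using odd \<open>d dvd k\<close> by (auto simp: A_def div_plus_div_distrib_dvd_right)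
  have A_m: "A (i + 2 * m) \<longleftrightarrow> A i" for i
  proof -
    have "(i + 2 * m) div d = i div d + 2 * (m div d)"
      using \<open>d dvd m\<close> by (simp add: div_plus_div_distrib_dvd_right div_mult_swap)
    then show ?thesis by (simp add: A_def)
  qed
  have gcd: "gcd k (2 * m) = d"
  proof -
    have "k = d * (k div d)" "m = d * (m div d)" using \<open>d dvd m\<close> \<open>d dvd k\<close> by simp_all
    then have "gcd k (2 * m) = d * gcd (k div d) (2 * (m div d))"
      by (metis gcd_mult_distrib_nat mult.left_commute)
    moreover have "coprime (k div d) (m div d)"
      using m unfolding d by (intro div_gcd_coprime) simp
    ultimately show ?thesis using odd by simp
  qed
  define f where "f T = (\<lambda>i. T i \<noteq> A i)" for T :: "nat \<Rightarrow> bool"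
  have "bij_betw f {T \<in> words (2 * m). shift k T = - T} (words d)"
  proof (rule bij_betw_byWitness[where f' = f])
    show "f ` {T \<in> words (2 * m). shift k T = - T} \<subseteq> words d"
    proof clarify
      fix T assume "T \<in> words (2 * m)" and k: "shift k T = - T"
      moreover have "T (i + k) = (\<not> T i)" for i using fun_cong[OF k, of i] by (simp add: shift_def)
      ultimately have "f T \<in> words k \<inter> words (2 * m)"
        by (auto simp: words_iff f_def A_k A_m)
      then show "f T \<in> words d" by (simp add: words_gcd gcd)
    qed
    show "f ` words d \<subseteq> {T \<in> words (2 * m). shift k T = - T}"
    proof clarify
      fix T assume "T \<in> words d"
      then have "T \<in> words k \<inter> words (2 * m)" by (simp add: words_gcd gcd)
      then show "f T \<in> words (2 * m) \<and> shift k (f T) = - f T"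
        by (auto simp: words_iff f_def A_k A_m shift_def)
    qed
  qed (auto simp: f_def)
  then show ?thesis by (rule bij_betw_same_card)
qed

text \<open>
  Shifting \<open>m / d\<close> times by \<open>k\<close> amounts to a shift by \<open>(k / d) m\<close>, a multiple of the period
  \<open>2 m\<close>, but would negate the word an odd number of times.
\<close>

lemma no_sc_words_fixed:
  assumes m: "m > 0" and d: "d = gcd k m" and even: "even (k div d)" and odd: "odd (m div d)"
  shows "{T \<in> words (2 * m). shift k T = - T} = {}"
proof safe
  fix T assume T: "T \<in> words (2 * m)" and k: "shift k T = - T"
  have flip: "T (k * j) \<longleftrightarrow> (T 0 \<noteq> odd j)" for j
  proof (induction j)
    case (Suc j)
    have "T (k * j + k) \<longleftrightarrow> \<not> T (k * j)" using fun_cong[OF k, of "k * j"] by (simp add: shift_def)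
    then show ?case using Suc by (simp add: algebra_simps)
  qed simp
  have "d dvd m" "d dvd k" using d by auto
  obtain q where q: "k div d = 2 * q" using even by blast
  have "k * (m div d) = (k div d) * m" using \<open>d dvd m\<close> \<open>d dvd k\<close> by (metis div_mult_swap dvd_div_mult)
  then have "k * (m div d) = 0 + (2 * m) * q" using q by simp
  then have "T (k * (m div d)) = T 0" using words_add_mult[OF T] by metis
  then show "T \<in> {}" using flip[of "m div d"] odd by simp
qed

text \<open>
  Replacing \<open>k\<close> by \<open>k + m\<close> leaves \<open>d = gcd k m\<close> unchanged and adds \<open>m / d\<close> to \<open>k / d\<close>. So for odd
  \<open>m / d\<close> exactly one of the two quotients is odd, and for even \<open>m / d\<close> both are, being coprime
  to \<open>m / d\<close>.
\<close>

lemma fixed_words_balance: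
  assumes m: "m > 0"
  shows "2 * card {T \<in> even_words m. shift k T = T} =
    card {T \<in> words (2 * m). shift k T = - T} + card {T \<in> words (2 * m). shift (k + m) T = - T}"
proof -
  define d where "d = gcd k m"
  have d': "d = gcd (k + m) m" by (simp add: d_def)
  have "d > 0" "d dvd m" "d dvd k" using m d_def by auto
  have cop: "coprime (k div d) (m div d)" using m unfolding d_def by (intro div_gcd_coprime) simp
  have plus: "(k + m) div d = k div d + m div d" 
    using \<open>d dvd m\<close> by (simp add: div_plus_div_distrib_dvd_right)
  note E = card_even_words_fixed[OF m d_def]
  note A = card_sc_words_fixed_odd[OF m d_def] card_sc_words_fixed_odd[OF m d']
  note B = no_sc_words_fixed[OF m d_def] no_sc_words_fixed[OF m d']
  consider "even (m div d)" "odd (k div d)" | "odd (m div d)" "odd (k div d)"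
    | "odd (m div d)" "even (k div d)"
    using cop coprime_common_divisor[of "k div d" "m div d" 2] by fastforce
  then show ?thesis
    by cases (simp_all add: E A B plus)
qed

lemma sum_lessThan_add: "(\<Sum>i<a + b. f i) = (\<Sum>i<a. f i) + (\<Sum>i<b. f (i + a))"
  for f :: "nat \<Rightarrow> nat"
  by (induction b) (simp_all add: add.commute)

lemma cyclic_action_shift:
  assumes "n > 0" and "X \<subseteq> words n" and "\<And>T k. T \<in> X \<Longrightarrow> shift k T \<in> X"
  shows "cyclic_action n shift X"
  using assms finite_subset[OF assms(2) finite_words]
  by unfold_locales (auto simp: shift_shift shift_0 words_def)

lemma weight_shift:
  assumes T: "T \<in> words n" shows "weight n (shift k T) = weight n T"
proof (induction k)
  case (Suc k)
  let ?S = "shift k T"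
  have S: "?S \<in> words n" using T by (rule words_shift)
  have w: "weight b S = (\<Sum>i<b. if S i then 1 else 0)" for b S
    by (simp add: weight_def sum.If_cases Collect_conj_eq lessThan_def)
  have "shift (Suc k) T = shift 1 ?S" by (simp add: shift_shift)
  moreover have "weight n ?S + (if ?S n then 1 else 0) = weight n (shift 1 ?S) + (if ?S 0 then 1 else 0)"
    using sum_lessThan_add[of "\<lambda>i. if ?S i then 1 else 0" n 1] 
      sum_lessThan_add[of "\<lambda>i. if ?S i then 1 else 0" 1 n]
    by (simp add: w shift_def add.commute)
  moreover have "?S n = ?S 0" using words_add_mult[OF S, of 0 1] by simp
  ultimately show ?case using Suc by (simp split: if_splits)
qed (simp add: shift_0)

lemma cyclic_action_even_words: "m > 0 \<Longrightarrow> cyclic_action (2 * m) shift (even_words m)"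
proof (rule cyclic_action_shift)
  show "even_words m \<subseteq> words (2 * m)" using words_mono[of m "2 * m"] by (auto simp: even_words_def)
  fix T k assume "T \<in> even_words m"
  moreover from this have "T \<in> words (2 * m)" using words_mono[of m "2 * m"] by (auto simp: even_words_def)
  ultimately show "shift k T \<in> even_words m" by (simp add: even_words_def words_shift weight_shift)
qed simp

lemma cyclic_action_sc_words: "n > 0 \<Longrightarrow> cyclic_action n shift (sc_words n)"
proof (rule cyclic_action_shift)
  fix T k assume "T \<in> sc_words n"
  then obtain j where "T \<in> words n" "shift j T = - T" by (auto simp: sc_words_def)
  then have "shift k T \<in> words n" "shift j (shift k T) = - shift k T"
    by (simp_all add: words_shift) (metis add.commute shift_compl shift_shift)
  then show "shift k T \<in> sc_words n" by (auto simp: sc_words_def)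
qed (auto simp: sc_words_def)

text \<open>
  Words of period \<open>m\<close> are regarded as words of period \<open>2 m\<close>, so that both counts are averages
  over the same group \<open>\<int>\<^sub>2\<^sub>m\<close>; summing \<open>fixed_words_balance\<close> over \<open>k\<close> counts every shift by \<open>k + m\<close> once
  more.
\<close>

theorem card_necklaces_eq:
  assumes m: "m > 0"
  shows "card (even_words m // orbit_rel shift (even_words m)) =
    card (sc_words (2 * m) // orbit_rel shift (sc_words (2 * m)))"
proof -
  interpret E: cyclic_action "2 * m" shift "even_words m" by (rule cyclic_action_even_words[OF m])
  interpret D: cyclic_action "2 * m" shift "sc_words (2 * m)"
    using m by (intro cyclic_action_sc_words) simp
  let ?E = "\<lambda>k. card {T \<in> even_words m. shift k T = T}"
  let ?D = "\<lambda>k. card {T \<in> words (2 * m). shift k T = - T}"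
  have E: "2 * m * card (even_words m // orbit_rel shift (even_words m)) = (\<Sum>k<2 * m. ?E k)"
    using E.twisted_burnside[of id] by (simp, metis shift_0)
  have "2 * m * card (sc_words (2 * m) // orbit_rel shift (sc_words (2 * m))) =
    (\<Sum>k<2 * m. card {T \<in> sc_words (2 * m). shift k T = - T})"
  proof (rule D.twisted_burnside)
    fix T assume "T \<in> sc_words (2 * m)"
    then obtain j where "shift j T = - T" by (auto simp: sc_words_def)
    then have "- T = shift j T" by (rule sym)
    then show "\<exists>j. - T = shift j T" by (rule exI)
  qed (rule shift_compl[symmetric])
  also have "\<dots> = (\<Sum>k<2 * m. ?D k)"
    by (intro sum.cong refl arg_cong[where f = card]) (auto simp: sc_words_def)
  finally have D: "2 * m * card (sc_words (2 * m) // orbit_rel shift (sc_words (2 * m))) = (\<Sum>k<2 * m. ?D k)" .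
  have per: "?D (k + 2 * m) = ?D k" for k
  proof -
    have "shift (k + 2 * m) T = shift k T" if "T \<in> words (2 * m)" for T
      using that by (metis (mono_tags) mem_Collect_eq shift_shift words_def)
    then show ?thesis by (intro arg_cong[where f = card]) auto
  qed
  have "2 * (\<Sum>k<2 * m. ?E k) = (\<Sum>k<2 * m. ?D k) + (\<Sum>k<2 * m. ?D (k + m))"
    using fixed_words_balance[OF m] by (simp add: sum_distrib_left sum.distrib)
  also have "(\<Sum>k<2 * m. ?D (k + m)) = (\<Sum>k<2 * m. ?D k)"
    using sum_lessThan_add[of ?D m m] sum_lessThan_add[of "\<lambda>k. ?D (k + m)" m m] per
    by (simp add: mult_2 add.assoc)
  finally have "(\<Sum>k<2 * m. ?E k) = (\<Sum>k<2 * m. ?D k)" by linarith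
  with E D have "2 * m * card (even_words m // orbit_rel shift (even_words m)) =
      2 * m * card (sc_words (2 * m) // orbit_rel shift (sc_words (2 * m)))" by (simp only:)
  then show ?thesis using m by (simp only: mult_cancel1) simp
qed

section \<open>Isomorphisms of circulants of prime order\<close>

text \<open>
  A set of permutations closed under \<open>f g\<^sup>-\<^sup>1 h\<close> is a coset of a subgroup, so its own left cosets
  partition the symmetric group. Isomorphisms between two different graphs form such a set
  without forming a group.
\<close>

lemma card_heap_dvd_fact:
  assumes "finite B" and perm: "I \<subseteq> {f. f permutes B}" and "I \<noteq> {}"
    and heap: "\<And>f g h. f \<in> I \<Longrightarrow> g \<in> I \<Longrightarrow> h \<in> I \<Longrightarrow> f \<circ> inv g \<circ> h \<in> I"
  shows "card I dvd fact (card B)"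
proof -
  let ?P = "{f. f permutes B}"
  define C where "C = (\<lambda>f. (\<circ>) f ` I) ` ?P"
  have fin: "finite ?P" using \<open>finite B\<close> by (rule finite_permutations)
  obtain i where i: "i \<in> I" using \<open>I \<noteq> {}\<close> by blast
  have U: "\<Union>C = ?P"
  proof
    show "\<Union>C \<subseteq> ?P" using perm by (auto simp: C_def intro: permutes_compose)
    show "?P \<subseteq> \<Union>C"
    proof
      fix h assume h: "h \<in> ?P"
      have "i permutes B" using i perm by blast
      then have "h = (h \<circ> inv i) \<circ> i" by (simp add: comp_assoc permutes_inv_o)
      moreover have "h \<circ> inv i \<in> ?P"
        using h \<open>i permutes B\<close> by (auto intro: permutes_compose permutes_inv)
      ultimately show "h \<in> \<Union>C" using i unfolding C_def by blast
    qed
  qed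
  have card_c: "card c = card I" if "c \<in> C" for c
  proof -
    from that obtain f where f: "f permutes B" "c = (\<circ>) f ` I" by (auto simp: C_def)
    have "inj_on ((\<circ>) f) I"
      by (rule inj_onI) (metis f(1) comp_assoc id_comp permutes_inv_o(2))
    then show ?thesis using f by (simp add: card_image)
  qed
  have sub: "(\<circ>) f ` I \<subseteq> (\<circ>) f' ` I" if "f \<circ> j = f' \<circ> j'" "j \<in> I" "j' \<in> I" for f f' j j'
  proof
    fix h assume "h \<in> (\<circ>) f ` I"
    then obtain l where l: "l \<in> I" "h = f \<circ> l" by blast
    have "j permutes B" using that perm by blast
    have "f' \<circ> (j' \<circ> inv j \<circ> l) = (f \<circ> j) \<circ> inv j \<circ> l" using that by (simp add: comp_assoc)
    also have "\<dots> = f \<circ> (j \<circ> inv j) \<circ> l" by (simp only: comp_assoc)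
    also have "\<dots> = h" using \<open>j permutes B\<close> l by (simp add: permutes_inv_o)
    finally show "h \<in> (\<circ>) f' ` I" using heap[of j' j l] that l by blast
  qed
  have "card I * card C = card (\<Union>C)"
  proof (rule card_partition)
    show "finite C" using fin by (simp add: C_def)
    show "finite (\<Union>C)" using fin U by simp
    fix c d assume "c \<in> C" "d \<in> C" "c \<noteq> d"
    then obtain f f' where f: "c = (\<circ>) f ` I" "d = (\<circ>) f' ` I" by (auto simp: C_def)
    show "c \<inter> d = {}"
    proof (rule ccontr)
      assume "c \<inter> d \<noteq> {}"
      then obtain j j' where "j \<in> I" "j' \<in> I" "f \<circ> j = f' \<circ> j'" unfolding f by blast
      then have "c = d" unfolding f using sub[of f j f' j'] sub[of f' j' f j] by simp
      then show False using \<open>c \<noteq> d\<close> by simp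
    qed
  qed (rule card_c)
  then have "card I * card C = fact (card B)"
    using U card_permutations[OF refl \<open>finite B\<close>] by simp
  then show ?thesis by (metis dvd_triv_left)
qed

definition translation_invariant :: "nat \<Rightarrow> nat rel \<Rightarrow> bool" where
  "translation_invariant p E \<longleftrightarrow>
     (\<forall>u<p. \<forall>v<p. \<forall>j. ((u + j) mod p, (v + j) mod p) \<in> E \<longleftrightarrow> (u, v) \<in> E)"

definition preserves :: "nat \<Rightarrow> nat rel \<Rightarrow> nat rel \<Rightarrow> (nat \<Rightarrow> nat) \<Rightarrow> bool" where
  "preserves p E F h \<longleftrightarrow> (\<forall>u<p. \<forall>v<p. (h u, h v) \<in> F \<longleftrightarrow> (u, v) \<in> E)"

text \<open>
  Requiring permutations of \<open>{1..<p}\<close> encodes that the isomorphisms fix \<open>0\<close>, and makes them the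
  identity outside the vertex set, so that there are only finitely many.
\<close>

definition based_isos :: "nat \<Rightarrow> nat rel \<Rightarrow> nat rel \<Rightarrow> (nat \<Rightarrow> nat) set" where
  "based_isos p E F = {f. f permutes {1..<p} \<and> preserves p E F f}"

text \<open>
  The map \<open>x \<mapsto> h x - h 0\<close> on residues. As \<open>h 0 < p\<close> in all uses, the subtraction does not
  truncate.
\<close>

definition rebase :: "nat \<Rightarrow> (nat \<Rightarrow> nat) \<Rightarrow> nat \<Rightarrow> nat" where
  "rebase p h x = (if x < p then (h x + (p - h 0)) mod p else x)"

definition translate_iso :: "nat \<Rightarrow> nat \<Rightarrow> (nat \<Rightarrow> nat) \<Rightarrow> nat \<Rightarrow> nat" where
  "translate_iso p k f = rebase p (\<lambda>x. f ((x + k) mod p))"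

lemma rebase_permutes:
  assumes h: "bij_betw h {..<p} {..<p}" and p: "p > 0"
  shows "rebase p h permutes {1..<p}"
proof (rule bij_imp_permutes)
  let ?r = "rebase p h"
  have lt: "h x < p" if "x < p" for x using h that by (auto simp: bij_betw_def)
  have r0: "?r 0 = 0" using lt[OF p] p by (simp add: rebase_def)
  have inj: "x = y" if "x < p" "y < p" "?r x = ?r y" for x y
  proof -
    have "[h x = h y] (mod p)"
      using that by (simp add: rebase_def cong_def[symmetric] cong_add_rcancel_nat)
    then have "h x = h y" using lt that by (simp add: cong_less_modulus_unique_nat)
    then show ?thesis using h that by (auto simp: bij_betw_def dest: inj_onD)
  qed
  have "?r ` {1..<p} \<subseteq> {1..<p}"
  proof clarify
    fix x assume x: "x \<in> {1..<p}"
    then have "?r x < p" by (simp add: rebase_def)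
    moreover have "?r x \<noteq> 0" using inj[of x 0] x r0 p by auto
    ultimately show "?r x \<in> {1..<p}" by simp
  qed
  moreover have "inj_on ?r {1..<p}" using inj by (auto intro!: inj_onI)
  ultimately show "bij_betw ?r {1..<p} {1..<p}"
    unfolding bij_betw_def by (simp add: endo_inj_surj)
  show "?r x = x" if "x \<notin> {1..<p}" for x
    using that r0 by (cases "x = 0") (auto simp: rebase_def)
qed

lemma rebase_in_based_isos:
  assumes h: "bij_betw h {..<p} {..<p}" and p: "p > 0" and pres: "preserves p E F h"
    and F: "translation_invariant p F"
  shows "rebase p h \<in> based_isos p E F"
proof -
  have lt: "h x < p" if "x < p" for x using h that by (auto simp: bij_betw_def)
  have "preserves p E F (rebase p h)"
    using pres F lt by (simp add: preserves_def translation_invariant_def rebase_def)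
  then show ?thesis using rebase_permutes[OF h p] by (simp add: based_isos_def)
qed

lemma based_isos_bij:
  assumes "f \<in> based_isos p E F" and "p > 0"
  shows "f 0 = 0" "bij_betw f {..<p} {..<p}"
proof -
  have f: "f permutes {1..<p}" using assms by (simp add: based_isos_def)
  then show "f 0 = 0" by (simp add: permutes_not_in)
  have "f permutes {..<p}" using f by (rule permutes_subset) auto
  then show "bij_betw f {..<p} {..<p}" by (rule permutes_imp_bij)
qed

lemma bij_betw_translation: "bij_betw (\<lambda>x. (x + k) mod p) {..<p} {..<p}" for p :: nat
proof -
  have "inj_on (\<lambda>x. (x + k) mod p) {..<p}"
  proof (rule inj_onI)
    fix x y assume "x \<in> {..<p}" "y \<in> {..<p}" "(x + k) mod p = (y + k) mod p"
    then show "x = y"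
      by (simp add: cong_def[symmetric] cong_add_rcancel_nat cong_less_modulus_unique_nat)
  qed
  moreover have "(\<lambda>x. (x + k) mod p) ` {..<p} \<subseteq> {..<p}" by auto
  ultimately show ?thesis unfolding bij_betw_def by (simp add: endo_inj_surj)
qed

text \<open>
  With \<open>translate_iso_eqI\<close>, the description of \<open>translate_iso\<close> by a congruence without subtraction,
  from which the laws of an action follow.
\<close>

lemma translate_iso_cong:
  assumes f: "f \<in> based_isos p E F" and x: "x < p"
  shows "translate_iso p k f x < p"
    and "[translate_iso p k f x + f (k mod p) = f ((x + k) mod p)] (mod p)"
proof -
  have p: "p > 0" using x by simp
  show "translate_iso p k f x < p" using x by (simp add: translate_iso_def rebase_def)
  have "f (k mod p) < p" using based_isos_bij[OF f p] p by (auto simp: bij_betw_def)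
  then show "[translate_iso p k f x + f (k mod p) = f ((x + k) mod p)] (mod p)"
    using x by (simp add: translate_iso_def rebase_def cong_def mod_add_left_eq)
qed

lemma translate_iso_eqI:
  assumes f: "f \<in> based_isos p E F"
    and out: "\<And>x. \<not> x < p \<Longrightarrow> g x = x" and lt: "\<And>x. x < p \<Longrightarrow> g x < p"
    and c: "\<And>x. x < p \<Longrightarrow> [g x + f (k mod p) = f ((x + k) mod p)] (mod p)"
  shows "g = translate_iso p k f"
proof
  fix x
  show "g x = translate_iso p k f x"
  proof (cases "x < p")
    case True
    have "[g x + f (k mod p) = translate_iso p k f x + f (k mod p)] (mod p)"
      using c[OF True] translate_iso_cong(2)[OF f True, of k] by (metis cong_sym cong_trans)
    then show ?thesis
      using lt[OF True] translate_iso_cong(1)[OF f True, of k]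
      by (simp add: cong_add_rcancel_nat cong_less_modulus_unique_nat)
  qed (simp add: out translate_iso_def rebase_def)
qed

lemma translate_iso_in_based_isos:
  assumes f: "f \<in> based_isos p E F" and p: "p > 0"
    and E: "translation_invariant p E" and F: "translation_invariant p F"
  shows "translate_iso p k f \<in> based_isos p E F"
  unfolding translate_iso_def
proof (rule rebase_in_based_isos[OF _ p _ F])
  show "bij_betw (\<lambda>x. f ((x + k) mod p)) {..<p} {..<p}"
    using bij_betw_trans[OF bij_betw_translation based_isos_bij(2)[OF f p]] by (simp add: comp_def)
  show "preserves p E F (\<lambda>x. f ((x + k) mod p))"
    using f E by (simp add: based_isos_def preserves_def translation_invariant_def)
qed

lemma cyclic_action_translate_iso:
  assumes p: "p > 0" and E: "translation_invariant p E" and F: "translation_invariant p F"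
  shows "cyclic_action p (translate_iso p) (based_isos p E F)"
proof
  show "p > 0" by (rule p)
  show "finite (based_isos p E F)"
    by (rule finite_subset[OF _ finite_permutations[of "{1..<p}"]]) (auto simp: based_isos_def)
  fix f assume f: "f \<in> based_isos p E F"
  note f_bij = based_isos_bij[OF f p]
  show "translate_iso p k f \<in> based_isos p E F" for k
    by (rule translate_iso_in_based_isos[OF f p E F])
  have f_out: "f x = x" if "\<not> x < p" for x
    using f that by (auto simp: based_isos_def permutes_not_in)
  have f_lt: "f x < p" if "x < p" for x using f_bij that by (auto simp: bij_betw_def)
  show "translate_iso p 0 f = f"
    by (rule translate_iso_eqI[OF f, symmetric]) (simp_all add: f_out f_lt f_bij)
  show "translate_iso p p f = f"
    by (rule translate_iso_eqI[OF f, symmetric]) (simp_all add: f_out f_lt f_bij)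
  show "translate_iso p j (translate_iso p k f) = translate_iso p (j + k) f" for j k
  proof (rule translate_iso_eqI[OF f])
    have g: "translate_iso p k f \<in> based_isos p E F"
      by (rule translate_iso_in_based_isos[OF f p E F])
    fix x
    show "translate_iso p j (translate_iso p k f) x = x" if "\<not> x < p"
      using that by (simp add: translate_iso_def rebase_def)
    assume x: "x < p"
    show "translate_iso p j (translate_iso p k f) x < p" by (rule translate_iso_cong[OF g x])
    let ?y = "translate_iso p j (translate_iso p k f) x"
    have 1: "[?y + translate_iso p k f (j mod p) = translate_iso p k f ((x + j) mod p)] (mod p)"
      by (rule translate_iso_cong[OF g x])
    have 2: "[translate_iso p k f (j mod p) + f (k mod p) = f ((j + k) mod p)] (mod p)"
      using translate_iso_cong(2)[OF f, of "j mod p" k] p by (simp add: mod_add_left_eq)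
    have 3: "[translate_iso p k f ((x + j) mod p) + f (k mod p) = f ((x + (j + k)) mod p)] (mod p)"
      using translate_iso_cong(2)[OF f, of "(x + j) mod p" k] p by (simp add: mod_add_left_eq add.assoc)
    have "[?y + f ((j + k) mod p) = ?y + (translate_iso p k f (j mod p) + f (k mod p))] (mod p)"
      using 2 by (simp add: cong_add_lcancel_nat cong_sym)
    also have "?y + (translate_iso p k f (j mod p) + f (k mod p)) = (?y + translate_iso p k f (j mod p)) + f (k mod p)"
      by simp
    also have "[\<dots> = translate_iso p k f ((x + j) mod p) + f (k mod p)] (mod p)"
      using 1 by (simp add: cong_add_rcancel_nat)
    also note 3
    finally show "[?y + f ((j + k) mod p) = f ((x + (j + k)) mod p)] (mod p)" .
  qed
qed

lemma based_isos_heap: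
  assumes p: "p > 0" and "f \<in> based_isos p E F" "g \<in> based_isos p E F" "h \<in> based_isos p E F"
  shows "f \<circ> inv g \<circ> h \<in> based_isos p E F"
proof -
  have perm: "f permutes {1..<p}" "g permutes {1..<p}" "h permutes {1..<p}"
    using assms by (simp_all add: based_isos_def)
  have lt: "h x < p" if "x < p" for x
    using based_isos_bij(2)[OF assms(4) p] that by (auto simp: bij_betw_def)
  have inv: "inv g x < p" "g (inv g x) = x" if "x < p" for x
  proof -
    have "inv g permutes {..<p}" using permutes_inv[OF perm(2)] by (rule permutes_subset) auto
    then show "inv g x < p" using that permutes_in_image[of "inv g" "{..<p}" x] by simp
    show "g (inv g x) = x" by (rule permutes_inverses(1)[OF perm(2)])
  qed
  have "preserves p E F (f \<circ> inv g \<circ> h)"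
    unfolding preserves_def
  proof (intro allI impI)
    fix u v assume uv: "u < p" "v < p"
    let ?u = "inv g (h u)" and ?v = "inv g (h v)"
    have "(f ?u, f ?v) \<in> F \<longleftrightarrow> (?u, ?v) \<in> E"
      using assms(2) inv lt uv by (simp add: based_isos_def preserves_def)
    also have "\<dots> \<longleftrightarrow> (g ?u, g ?v) \<in> F"
      using assms(3) inv(1) lt uv by (simp add: based_isos_def preserves_def)
    also have "\<dots> \<longleftrightarrow> (u, v) \<in> E"
      using assms(4) inv lt uv by (simp add: based_isos_def preserves_def)
    finally show "((f \<circ> inv g \<circ> h) u, (f \<circ> inv g \<circ> h) v) \<in> F \<longleftrightarrow> (u, v) \<in> E" by simp
  qed
  moreover have "f \<circ> inv g \<circ> h permutes {1..<p}"
    using perm by (intro permutes_compose permutes_inv)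
  ultimately show ?thesis by (simp add: based_isos_def)
qed

text \<open>
  If no \<open>k\<close> with \<open>0 < k < p\<close> had a fixed point on the isomorphisms fixing \<open>0\<close>, then \<open>p\<close> would
  divide their number, which in turn divides \<open>(p - 1)!\<close>.
\<close>

theorem prime_circulant_iso_multiplier:
  assumes prime: "prime p" and E: "translation_invariant p E" and F: "translation_invariant p F"
    and h: "bij_betw h {..<p} {..<p}" "preserves p E F h"
  obtains a where "\<not> p dvd a" and "preserves p E F (\<lambda>x. a * x mod p)"
proof -
  have p: "p > 0" using prime by (rule prime_gt_0_nat)
  let ?I = "based_isos p E F"
  interpret cyclic_action p "translate_iso p" ?I
    by (rule cyclic_action_translate_iso[OF p E F])
  have I_ne: "?I \<noteq> {}" using rebase_in_based_isos[OF h(1) p h(2) F] by blast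
  have "card ?I dvd fact (card {1..<p})"
  proof (intro card_heap_dvd_fact)
    show "?I \<subseteq> {f. f permutes {1..<p}}" by (auto simp: based_isos_def)
  qed (simp_all add: I_ne based_isos_heap[OF p])
  moreover have "\<not> p dvd fact (card {1..<p})"
    using prime p by (simp add: prime_dvd_fact_iff)
  ultimately have ndvd: "\<not> p dvd card ?I" by (meson dvd_trans)
  have "\<exists>k\<in>{1..<p}. {f \<in> ?I. translate_iso p k f = f} \<noteq> {}"
  proof (rule ccontr)
    assume none: "\<not> ?thesis"
    have zero: "card {f \<in> ?I. translate_iso p k f = f} = 0" if "k \<in> {1..<p}" for k
    proof -
      have "{f \<in> ?I. translate_iso p k f = f} = {}" using that none by blast
      then show ?thesis by (simp only: card.empty)
    qed
    have "p * card (?I // orbit_rel (translate_iso p) ?I) = (\<Sum>k<p. card {f \<in> ?I. translate_iso p k f = id f})"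
      by (rule twisted_burnside) (auto intro: act_0[symmetric])
    also have "\<dots> = (\<Sum>k\<in>{0}. card {f \<in> ?I. translate_iso p k f = id f})"
    proof (rule sum.mono_neutral_right)
      show "\<forall>k\<in>{..<p} - {0}. card {f \<in> ?I. translate_iso p k f = id f} = 0"
        using zero by simp
    qed (use p in simp_all)
    also have "{f \<in> ?I. translate_iso p 0 f = id f} = ?I" using act_0 by auto
    then have "(\<Sum>k\<in>{0}. card {f \<in> ?I. translate_iso p k f = id f}) = card ?I" by simp
    finally show False using ndvd by (metis dvd_triv_left)
  qed
  then obtain k f where k: "0 < k" "k < p" and f: "f \<in> ?I" and fix_f: "translate_iso p k f = f"
    by (auto simp: Suc_le_eq)
  note f_bij = based_isos_bij[OF f p]
  have step: "[f x + f k = f ((x + k) mod p)] (mod p)" if "x < p" for x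
    using translate_iso_cong(2)[OF f that, of k] k fix_f by simp
  \<comment> \<open>As \<open>k\<close> generates \<open>\<int>\<^sub>p\<close>, this determines \<open>f\<close>.\<close>
  have lin: "[f ((i * k) mod p) = i * f k] (mod p)" for i
  proof (induction i)
    case (Suc i)
    have "f ((Suc i * k) mod p) = f (((i * k) mod p + k) mod p)" by (simp add: mod_add_right_eq add.commute)
    also have "[\<dots> = f ((i * k) mod p) + f k] (mod p)" using step[of "(i * k) mod p"] p by (simp add: cong_sym)
    also have "[f ((i * k) mod p) + f k = i * f k + f k] (mod p)" using Suc by (simp add: cong_add_rcancel_nat)
    finally show ?case by (simp add: add.commute)
  qed (simp add: f_bij)
  have "\<not> p dvd k" using k by (simp add: nat_dvd_not_less)
  then have "coprime k p" using prime_imp_coprime[OF prime] by (simp add: coprime_commute)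
  then obtain k' where k': "[k * k' = 1] (mod p)" using cong_solve_coprime_nat[of k p] by auto
  define a where "a = k' * f k"
  have f_eq: "f x = a * x mod p" if "x < p" for x
  proof -
    have "[x * k' * k = x * 1] (mod p)" using cong_scalar_left[OF k', of x] by (simp add: mult_ac)
    then have "(x * k' * k) mod p = x" using that by (simp add: cong_def)
    then have "[f x = x * k' * f k] (mod p)" using lin[of "x * k'"] by simp
    then have "[f x = a * x] (mod p)" by (simp add: a_def mult_ac)
    moreover have "f x < p" using f_bij that by (auto simp: bij_betw_def)
    ultimately show ?thesis by (simp add: cong_def)
  qed
  have "preserves p E F (\<lambda>x. a * x mod p)"
    using f f_eq by (simp add: based_isos_def preserves_def)
  moreover have "\<not> p dvd a"
  proof
    assume "p dvd a"
    then have "f k = f 0" using f_eq[OF k(2)] f_bij by simp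
    then show False using inj_onD[OF bij_betw_imp_inj_on[OF f_bij(2)], of k 0] k by simp
  qed
  ultimately show ?thesis using that by blast
qed

section \<open>From circulants to words\<close>

text \<open>
  Without parallel arcs, the arc component of an isomorphism is determined by its vertex map.
\<close>

lemma digraph_iso_iff:
  assumes G: "pair_wf_digraph G" and H: "pair_wf_digraph H"
  shows "digraph_iso (with_proj G) (with_proj H) \<longleftrightarrow>
    (\<exists>h. bij_betw h (pverts G) (pverts H) \<and>
      (\<forall>u\<in>pverts G. \<forall>v\<in>pverts G. (h u, h v) \<in> parcs H \<longleftrightarrow> (u, v) \<in> parcs G))"
    (is "?L \<longleftrightarrow> ?R")
proof
  assume ?L
  then obtain f where f: "pre_digraph.digraph_isomorphism (with_proj G) f"
    and H_eq: "with_proj H = app_iso f (with_proj G)" by (auto simp: digraph_iso_def)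
  let ?h = "iso_verts f"
  have inj: "inj_on ?h (pverts G)"
    using f by (simp add: pre_digraph.digraph_isomorphism_def)
  have verts: "pverts H = ?h ` pverts G"
    using arg_cong[OF H_eq, of verts] by (simp add: app_iso_def)
  have arcs: "parcs H = iso_arcs f ` parcs G"
    using arg_cong[OF H_eq, of arcs] by (simp add: app_iso_def)
  have tail: "iso_tail f = fst" using arg_cong[OF H_eq, of tail] by (simp add: app_iso_def)
  have head: "iso_head f = snd" using arg_cong[OF H_eq, of head] by (simp add: app_iso_def)
  have map: "iso_arcs f (u, v) = (?h u, ?h v)" if "(u, v) \<in> parcs G" for u v
    using f that tail head by (force simp: pre_digraph.digraph_isomorphism_def prod_eq_iff)
  have "(?h u, ?h v) \<in> parcs H \<longleftrightarrow> (u, v) \<in> parcs G"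
    if uv: "u \<in> pverts G" "v \<in> pverts G" for u v
  proof
    assume "(?h u, ?h v) \<in> parcs H"
    then obtain x y where xy: "(x, y) \<in> parcs G" "iso_arcs f (x, y) = (?h u, ?h v)"
      unfolding arcs by fastforce
    then have "?h x = ?h u" "?h y = ?h v" using map by auto
    moreover have "x \<in> pverts G" "y \<in> pverts G"
      using xy(1) G by (auto dest: pair_wf_digraph.in_arcsD1 pair_wf_digraph.in_arcsD2)
    ultimately show "(u, v) \<in> parcs G" using xy(1) inj uv by (metis inj_onD)
  next
    assume "(u, v) \<in> parcs G"
    then show "(?h u, ?h v) \<in> parcs H" unfolding arcs using map by (metis imageI)
  qed
  then show ?R using inj verts by (auto simp: bij_betw_def)
next
  assume ?R
  then obtain h where h: "bij_betw h (pverts G) (pverts H)"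
    and pres: "\<And>u v. u \<in> pverts G \<Longrightarrow> v \<in> pverts G \<Longrightarrow> (h u, h v) \<in> parcs H \<longleftrightarrow> (u, v) \<in> parcs G"
    by blast
  let ?f = "\<lparr>iso_verts = h, iso_arcs = map_prod h h, iso_head = snd, iso_tail = fst\<rparr>"
  have G_arcs: "parcs G \<subseteq> pverts G \<times> pverts G" and H_arcs: "parcs H \<subseteq> pverts H \<times> pverts H"
    using G H by (auto dest: pair_wf_digraph.in_arcsD1 pair_wf_digraph.in_arcsD2)
  have inj: "inj_on h (pverts G)" and img: "h ` pverts G = pverts H"
    using h by (auto simp: bij_betw_def)
  have "inj_on (map_prod h h) (parcs G)"
    using map_prod_inj_on[OF inj inj] G_arcs by (rule inj_on_subset)
  then have "pre_digraph.digraph_isomorphism (with_proj G) ?f"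
    using G inj by (simp add: pre_digraph.digraph_isomorphism_def wf_digraph_wp_iff)
  moreover have "parcs H = map_prod h h ` parcs G"
  proof
    show "map_prod h h ` parcs G \<subseteq> parcs H" using G_arcs pres by auto
    show "parcs H \<subseteq> map_prod h h ` parcs G"
    proof clarify
      fix x y assume xy: "(x, y) \<in> parcs H"
      then obtain u v where "u \<in> pverts G" "v \<in> pverts G" "x = h u" "y = h v"
        using H_arcs img by blast
      then show "(x, y) \<in> map_prod h h ` parcs G" using xy pres by (intro image_eqI[of _ _ "(u, v)"]) auto
    qed
  qed
  then have "with_proj H = app_iso ?f (with_proj G)"
    using img by (simp add: app_iso_def with_proj_def)
  ultimately show ?L unfolding digraph_iso_def by blast
qed

lemma circulant_translation_invariant:
  assumes "circulant p G" and p: "p > 0"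
  shows "translation_invariant p (parcs G)"
proof -
  have step: "(cyclic_shift p u, cyclic_shift p v) \<in> parcs G" if "(u, v) \<in> parcs G" for u v
    using assms that by (force simp: circulant_def)
  have trans: "((u + j) mod p, (v + j) mod p) \<in> parcs G" if "(u, v) \<in> parcs G" "u < p" "v < p" for u v j
  proof (induction j)
    case (Suc j)
    from step[OF this] show ?case by (simp add: cyclic_shift_def mod_Suc_eq)
  qed (use that in simp)
  show ?thesis
    unfolding translation_invariant_def
  proof (intro allI impI iffI)
    fix u v j assume uv: "u < p" "v < p" and "((u + j) mod p, (v + j) mod p) \<in> parcs G"
    \<comment> \<open>The translation by \<open>p * j - j\<close> undoes that by \<open>j\<close>.\<close>
    from trans[OF this(3) mod_less_divisor[OF p] mod_less_divisor[OF p], of "p * j - j"]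
    have "((u + j + (p * j - j)) mod p, (v + j + (p * j - j)) mod p) \<in> parcs G"
      using p by (simp only: mod_add_left_eq)
    moreover have "x + j + (p * j - j) = x + p * j" for x using p by simp
    ultimately show "(u, v) \<in> parcs G" using uv by simp
  qed (rule trans)
qed

lemma circulantI:
  assumes "pair_digraph G" and verts: "pverts G = {0..<p}" and inv: "translation_invariant p (parcs G)"
  shows "circulant p G"
proof -
  interpret pair_digraph G by fact
  have arcs: "parcs G \<subseteq> {0..<p} \<times> {0..<p}" using wellformed' verts by auto
  have "map_prod (cyclic_shift p) (cyclic_shift p) ` parcs G = parcs G"
  proof
    show "map_prod (cyclic_shift p) (cyclic_shift p) ` parcs G \<subseteq> parcs G"
    proof clarsimp
      fix u v assume uv: "(u, v) \<in> parcs G"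
      then have "u < p" "v < p" using arcs by auto
      then have "((u + 1) mod p, (v + 1) mod p) \<in> parcs G"
        using inv uv unfolding translation_invariant_def by blast
      then show "(cyclic_shift p u, cyclic_shift p v) \<in> parcs G" by (simp add: cyclic_shift_def)
    qed
    show "parcs G \<subseteq> map_prod (cyclic_shift p) (cyclic_shift p) ` parcs G"
    proof clarify
      fix u v assume uv: "(u, v) \<in> parcs G"
      then have lt: "u < p" "v < p" using arcs by auto
      then have "((u + (p - 1)) mod p, (v + (p - 1)) mod p) \<in> parcs G"
        using inv uv unfolding translation_invariant_def by blast
      moreover have "cyclic_shift p ((x + (p - 1)) mod p) = x" if "x < p" for x
        using that by (simp add: cyclic_shift_def mod_Suc_eq)
      ultimately show "(u, v) \<in> map_prod (cyclic_shift p) (cyclic_shift p) ` parcs G"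
        using lt by (metis map_prod_simp image_eqI)
    qed
  qed
  then show ?thesis using assms by (simp add: circulant_def)
qed

lemma card_quotient_image:
  assumes inj: "inj_on f A" and R: "R \<subseteq> A \<times> A"
    and S: "\<And>x y. x \<in> A \<Longrightarrow> y \<in> A \<Longrightarrow> (f x, f y) \<in> S \<longleftrightarrow> (x, y) \<in> R"
    and S_sub: "S \<subseteq> f ` A \<times> f ` A"
  shows "card ((f ` A) // S) = card (A // R)"
proof -
  have "S `` {f x} = f ` (R `` {x})" if "x \<in> A" for x
  proof (intro equalityI subsetI)
    fix z assume "z \<in> S `` {f x}"
    moreover from this obtain y where "y \<in> A" "z = f y" using S_sub by blast
    ultimately show "z \<in> f ` (R `` {x})" using S that by blast
  next
    fix z assume "z \<in> f ` (R `` {x})"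
    then show "z \<in> S `` {f x}" using S R that by blast
  qed
  then have "(f ` A) // S = (`) f ` (A // R)"
    by (auto simp: quotient_def)
  moreover have "inj_on ((`) f) (A // R)"
  proof (rule inj_onI)
    fix B C assume "B \<in> A // R" "C \<in> A // R" "f ` B = f ` C"
    moreover from this have "B \<subseteq> A" "C \<subseteq> A" using R by (auto simp: quotient_def)
    ultimately show "B = C" using inj by (simp add: inj_on_image_eq_iff)
  qed
  ultimately show ?thesis by (simp add: card_image)
qed

text \<open>
  The Cayley digraph of \<open>\<int>\<^sub>p\<close> whose connection set consists of the powers \<open>g ^ i\<close> with \<open>T i\<close>.
\<close>

definition word_graph :: "nat \<Rightarrow> nat \<Rightarrow> (nat \<Rightarrow> bool) \<Rightarrow> nat pair_pre_digraph" where
  "word_graph p g T = \<lparr> pverts = {0..<p},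
     parcs = {(u, v). u < p \<and> v < p \<and> (\<exists>i. T i \<and> [u + g ^ i = v] (mod p))} \<rparr>"

locale prime_root =
  fixes p g :: nat
  assumes prime: "prime p" and odd: "odd p" and root: "residue_primroot p g"
begin

lemma p_gt_2: "p > 2"
  using prime odd by (metis even_numeral nat_less_le prime_ge_2_nat)

lemma power_cong_iff: "[g ^ i = g ^ j] (mod p) \<longleftrightarrow> [i = j] (mod (p - 1))"
  using root prime order_divides_expdiff[of p g i j]
  by (simp add: residue_primroot_def totient_prime)

lemma power_not_dvd: "\<not> p dvd g ^ i"
proof
  assume "p dvd g ^ i"
  then have "p dvd g" using prime prime_dvd_power by blast
  moreover have "coprime p g" using root by (simp add: residue_primroot_def)
  ultimately show False using prime by (metis coprime_absorb_left not_prime_unit)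
qed

lemma power_surj:
  assumes "\<not> p dvd a" shows "\<exists>i. [g ^ i = a] (mod p)"
proof -
  have p1: "p > 1" using p_gt_2 by simp
  have "a mod p \<in> totatives p"
    using assms p_gt_2 prime by (auto simp: in_totatives_iff totatives_prime dvd_eq_mod_eq_0)
  then obtain i where "a mod p = g ^ i mod p"
    using residue_primroot_is_generator[OF p1 root] by (auto simp: bij_betw_def)
  then show ?thesis by (auto simp: cong_def)
qed

lemma difference_is_power:
  assumes "u < p" "v < p" "u \<noteq> v" shows "\<exists>i. [u + g ^ i = v] (mod p)"
proof -
  have "\<not> p dvd v + p - u"
  proof
    assume "p dvd v + p - u"
    then have "[u + (v + p - u) = u + 0] (mod p)"
      unfolding cong_add_lcancel_nat by (simp add: cong_0_iff)
    then have "[v = u] (mod p)" using assms by (simp add: cong_def)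
    then show False using assms by (simp add: cong_def)
  qed
  then obtain i where "[g ^ i = v + p - u] (mod p)" using power_surj by blast
  then have "[u + g ^ i = u + (v + p - u)] (mod p)" by (simp add: cong_add_lcancel_nat)
  then show ?thesis using assms by (auto simp: cong_def)
qed

lemma add_power_not_cong: "\<not> [u + g ^ i = u] (mod p)"
  using power_not_dvd[of i] by (simp add: cong_add_lcancel_0_nat cong_0_iff)

lemma arc_iff:
  assumes T: "T \<in> words (p - 1)" and uv: "u < p" "v < p" and i: "[u + g ^ i = v] (mod p)"
  shows "(u, v) \<in> parcs (word_graph p g T) \<longleftrightarrow> T i"
proof
  assume "(u, v) \<in> parcs (word_graph p g T)"
  then obtain j where j: "T j" "[u + g ^ j = v] (mod p)" by (auto simp: word_graph_def)
  then have "[u + g ^ i = u + g ^ j] (mod p)" using i by (metis cong_sym cong_trans)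
  then have "[i = j] (mod (p - 1))" by (simp add: cong_add_lcancel_nat power_cong_iff)
  then show "T i" using words_cong[OF T] j by blast
next
  assume "T i"
  then show "(u, v) \<in> parcs (word_graph p g T)" using uv i by (auto simp: word_graph_def)
qed

lemma arc_iff_mod:
  assumes T: "T \<in> words (p - 1)" and u: "u < p"
  shows "(u, (u + g ^ i) mod p) \<in> parcs (word_graph p g T) \<longleftrightarrow> T i"
  using arc_iff[OF T u, of "(u + g ^ i) mod p" i] p_gt_2 by (simp add: cong_def)

lemma no_loop: "(u, u) \<notin> parcs (word_graph p g T)"
  by (auto simp: word_graph_def add_power_not_cong)

lemma word_graph_ext:
  assumes T: "T \<in> words (p - 1)" and verts: "pverts G = {0..<p}"
    and arcs: "parcs G \<subseteq> {0..<p} \<times> {0..<p}" and loops: "\<And>u. (u, u) \<notin> parcs G"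
    and iff: "\<And>u v i. u < p \<Longrightarrow> v < p \<Longrightarrow> [u + g ^ i = v] (mod p) \<Longrightarrow> (u, v) \<in> parcs G \<longleftrightarrow> T i"
  shows "G = word_graph p g T"
proof (rule pair_pre_digraph.equality)
  show "parcs G = parcs (word_graph p g T)"
  proof (rule Set.set_eqI)
    fix e :: "nat \<times> nat"
    obtain u v where e: "e = (u, v)" by (cases e)
    show "e \<in> parcs G \<longleftrightarrow> e \<in> parcs (word_graph p g T)"
    proof (cases "u < p \<and> v < p \<and> u \<noteq> v")
      case True
      then obtain i where "[u + g ^ i = v] (mod p)" using difference_is_power by blast
      then show ?thesis using iff arc_iff[OF T] True by (simp add: e)
    next
      case False
      then show ?thesis using arcs loops no_loop by (auto simp: e word_graph_def)
    qed
  qed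
qed (simp_all add: verts word_graph_def)

lemma pair_digraph_word_graph: "pair_digraph (word_graph p g T)"
proof
  show "finite (parcs (word_graph p g T))"
    by (rule finite_subset[of _ "{..<p} \<times> {..<p}"]) (auto simp: word_graph_def)
  show "fst e \<noteq> snd e" if "e \<in> parcs (word_graph p g T)" for e
    using that no_loop by (cases e) auto
qed (auto simp: word_graph_def)

lemma pair_wf_digraph_word_graph: "pair_wf_digraph (word_graph p g T)"
  using pair_digraph_word_graph
  by (simp add: pair_digraph_def pair_fin_digraph_def)

lemma translation_invariant_word_graph: "translation_invariant p (parcs (word_graph p g T))"
proof -
  have "[(u + j) mod p + g ^ i = (v + j) mod p] (mod p) \<longleftrightarrow> [u + g ^ i = v] (mod p)" for u v i j
  proof -
    have "[(u + j) mod p + g ^ i = (v + j) mod p] (mod p) \<longleftrightarrow> [(u + g ^ i) + j = v + j] (mod p)"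
      by (simp add: cong_def mod_add_right_eq add.commute add.left_commute add.assoc)
    then show ?thesis by (simp add: cong_add_rcancel_nat)
  qed
  then show ?thesis using p_gt_2 by (auto simp: translation_invariant_def word_graph_def)
qed

lemma circulant_word_graph: "circulant p (word_graph p g T)"
  by (rule circulantI[OF pair_digraph_word_graph _ translation_invariant_word_graph])
    (simp add: word_graph_def)

lemma circulant_is_word_graph:
  assumes "circulant p G" shows "\<exists>T\<in>words (p - 1). G = word_graph p g T"
proof
  interpret pair_digraph G using assms by (simp add: circulant_def)
  let ?T = "\<lambda>i. (0, g ^ i mod p) \<in> parcs G"
  have p: "p > 0" using p_gt_2 by simp
  note inv = circulant_translation_invariant[OF assms p]
  have "[g ^ (i + (p - 1)) = g ^ i] (mod p)" for i
    by (simp add: power_cong_iff) (simp add: cong_def)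
  then show T: "?T \<in> words (p - 1)" by (simp add: words_iff cong_def)
  show "G = word_graph p g ?T"
  proof (rule word_graph_ext[OF T])
    show verts: "pverts G = {0..<p}" using assms by (simp add: circulant_def)
    show "parcs G \<subseteq> {0..<p} \<times> {0..<p}" using wellformed' verts by auto
    show "(u, u) \<notin> parcs G" for u using pair_no_loops[of "(u, u)"] by auto
    fix u v i assume uv: "u < p" "v < p" "[u + g ^ i = v] (mod p)"
    have "((0 + u) mod p, (g ^ i mod p + u) mod p) \<in> parcs G \<longleftrightarrow> ?T i"
      using inv p unfolding translation_invariant_def by (meson mod_less_divisor)
    moreover have "(g ^ i mod p + u) mod p = v"
      using uv by (simp add: cong_def mod_add_right_eq add.commute)
    ultimately show "(u, v) \<in> parcs G \<longleftrightarrow> ?T i" using uv by simp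
  qed
qed

lemma inj_on_word_graph: "inj_on (word_graph p g) (words (p - 1))"
proof (rule inj_onI, rule ext)
  fix S T i assume ST: "S \<in> words (p - 1)" "T \<in> words (p - 1)" "word_graph p g S = word_graph p g T"
  then show "S i = T i"
    using arc_iff_mod[OF ST(1), of 0 i] arc_iff_mod[OF ST(2), of 0 i] p_gt_2 by simp
qed

lemma complement_word_graph:
  assumes T: "T \<in> words (p - 1)"
  shows "complement (word_graph p g T) = word_graph p g (- T)"
proof (rule word_graph_ext[OF words_compl[OF T]])
  fix u v i assume uv: "u < p" "v < p" "[u + g ^ i = v] (mod p)"
  then have "u \<noteq> v" using add_power_not_cong by blast
  then show "(u, v) \<in> parcs (complement (word_graph p g T)) \<longleftrightarrow> (- T) i"
    using uv arc_iff[OF T uv] by (simp add: complement_def) (simp add: word_graph_def)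
qed (auto simp: complement_def word_graph_def)

lemma preserves_power_multiplier:
  assumes S: "S \<in> words (p - 1)" and T: "T \<in> words (p - 1)" and a: "[g ^ k = a] (mod p)"
  shows "preserves p (parcs (word_graph p g S)) (parcs (word_graph p g T)) (\<lambda>x. a * x mod p)
    \<longleftrightarrow> S = shift k T"
proof -
  have arc: "(a * u mod p, a * v mod p) \<in> parcs (word_graph p g T) \<longleftrightarrow> shift k T i"
    if "[u + g ^ i = v] (mod p)" for u v i
  proof -
    have "[a * u + g ^ (i + k) = a * u + a * g ^ i] (mod p)"
      using cong_scalar_left[OF a, of "g ^ i"] by (simp add: cong_add_lcancel_nat power_add mult.commute)
    also have "a * u + a * g ^ i = a * (u + g ^ i)" by (simp add: algebra_simps)
    also have "[\<dots> = a * v] (mod p)" using that by (rule cong_scalar_left)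
    finally have "[a * u mod p + g ^ (i + k) = a * v mod p] (mod p)"
      by (simp add: cong_def mod_add_left_eq)
    then show ?thesis using arc_iff[OF T, of "a * u mod p" "a * v mod p" "i + k"] p_gt_2
      by (simp add: shift_def)
  qed
  show ?thesis
  proof
    assume pres: "preserves p (parcs (word_graph p g S)) (parcs (word_graph p g T)) (\<lambda>x. a * x mod p)"
    show "S = shift k T"
    proof
      fix i
      have c: "[0 + g ^ i = g ^ i mod p] (mod p)" by (simp add: cong_def)
      have "S i \<longleftrightarrow> (0, g ^ i mod p) \<in> parcs (word_graph p g S)"
        using arc_iff[OF S _ _ c] p_gt_2 by simp
      also have "\<dots> \<longleftrightarrow> (a * 0 mod p, a * (g ^ i mod p) mod p) \<in> parcs (word_graph p g T)"
        using pres[unfolded preserves_def, rule_format, of 0 "g ^ i mod p"] p_gt_2 by simp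
      also have "\<dots> \<longleftrightarrow> shift k T i" by (rule arc[OF c])
      finally show "S i = shift k T i" .
    qed
  next
    assume eq: "S = shift k T"
    show "preserves p (parcs (word_graph p g S)) (parcs (word_graph p g T)) (\<lambda>x. a * x mod p)"
      unfolding preserves_def
    proof (intro allI impI)
      fix u v assume uv: "u < p" "v < p"
      show "(a * u mod p, a * v mod p) \<in> parcs (word_graph p g T) \<longleftrightarrow> (u, v) \<in> parcs (word_graph p g S)"
      proof (cases "u = v")
        case False
        then obtain i where "[u + g ^ i = v] (mod p)" using difference_is_power uv by blast
        then show ?thesis using arc arc_iff[OF S uv] eq by simp
      qed (simp add: no_loop)
    qed
  qed
qed

lemma multiplication_bij:
  assumes "\<not> p dvd a" shows "bij_betw (\<lambda>x. a * x mod p) {..<p} {..<p}"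
proof -
  have cop: "coprime a p" using prime_imp_coprime[OF prime assms] by (simp add: coprime_commute)
  have "inj_on (\<lambda>x. a * x mod p) {..<p}"
  proof (rule inj_onI)
    fix x y assume "x \<in> {..<p}" "y \<in> {..<p}" "a * x mod p = a * y mod p"
    then show "x = y"
      using cop by (simp add: cong_def[symmetric] cong_mult_lcancel_nat cong_less_modulus_unique_nat)
  qed
  moreover have "(\<lambda>x. a * x mod p) ` {..<p} \<subseteq> {..<p}" using p_gt_2 by auto
  ultimately show ?thesis unfolding bij_betw_def by (simp add: endo_inj_surj)
qed

text \<open>
  Every multiplier is a power of \<open>g\<close>, and the multiplier \<open>g ^ k\<close> acts on words as the shift by
  \<open>k\<close>.
\<close>

lemma word_graph_iso_iff:
  assumes S: "S \<in> words (p - 1)" and T: "T \<in> words (p - 1)"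
  shows "digraph_iso (with_proj (word_graph p g S)) (with_proj (word_graph p g T)) \<longleftrightarrow>
    (\<exists>k. S = shift k T)" (is "?L \<longleftrightarrow> ?R")
proof -
  let ?E = "parcs (word_graph p g S)" and ?F = "parcs (word_graph p g T)"
  have "?L \<longleftrightarrow> (\<exists>h. bij_betw h {..<p} {..<p} \<and> preserves p ?E ?F h)"
    unfolding digraph_iso_iff[OF pair_wf_digraph_word_graph pair_wf_digraph_word_graph]
    by (simp add: preserves_def word_graph_def atLeast0LessThan Ball_def)
  also have "\<dots> \<longleftrightarrow> ?R"
  proof
    assume "\<exists>h. bij_betw h {..<p} {..<p} \<and> preserves p ?E ?F h"
    then obtain a where a: "\<not> p dvd a" "preserves p ?E ?F (\<lambda>x. a * x mod p)"
      using prime_circulant_iso_multiplier[OF prime translation_invariant_word_graph translation_invariant_word_graph]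
      by blast
    then show ?R using power_surj preserves_power_multiplier[OF S T] by blast
  next
    assume ?R
    then obtain k where "S = shift k T" by blast
    then have "preserves p ?E ?F (\<lambda>x. g ^ k * x mod p)"
      using preserves_power_multiplier[OF S T, of k "g ^ k"] by simp
    then show "\<exists>h. bij_betw h {..<p} {..<p} \<and> preserves p ?E ?F h"
      using multiplication_bij[OF power_not_dvd] by blast
  qed
  finally show ?thesis .
qed

lemma num_iso_classes_word_graphs:
  assumes X: "cyclic_action (p - 1) shift X" "X \<subseteq> words (p - 1)"
  shows "num_iso_classes (word_graph p g ` X) = card (X // orbit_rel shift X)"
  unfolding num_iso_classes_def
proof (rule card_quotient_image)
  interpret cyclic_action "p - 1" shift X by fact
  show "inj_on (word_graph p g) X" using inj_on_word_graph X(2) by (rule inj_on_subset)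
  show "orbit_rel shift X \<subseteq> X \<times> X" using equiv_orbit_rel by (simp add: equiv_def)
  fix S T assume ST: "S \<in> X" "T \<in> X"
  then have "(word_graph p g S, word_graph p g T) \<in> iso_rel (word_graph p g ` X) \<longleftrightarrow> (\<exists>k. S = shift k T)"
    using word_graph_iso_iff[of S T] X(2) by (auto simp: iso_rel_def)
  also have "\<dots> \<longleftrightarrow> (T, S) \<in> orbit_rel shift X" using ST by (simp add: orbit_rel_def)
  also have "\<dots> \<longleftrightarrow> (S, T) \<in> orbit_rel shift X"
    using equiv_orbit_rel by (meson equivE symE)
  finally show "(word_graph p g S, word_graph p g T) \<in> iso_rel (word_graph p g ` X)
    \<longleftrightarrow> (S, T) \<in> orbit_rel shift X" .
qed (auto simp: iso_rel_def)

text \<open>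
  Some power \<open>g ^ i\<close> is congruent to \<open>-1\<close>; its square being \<open>1\<close>, the exponent is a multiple of
  \<open>(p - 1) / 2\<close>, and an odd one because \<open>-1\<close> and \<open>1\<close> are different.
\<close>

lemma power_half_cong: "[g ^ ((p - 1) div 2) + 1 = 0] (mod p)"
proof -
  define m where "m = (p - 1) div 2"
  have m: "p - 1 = 2 * m" using odd by (simp add: m_def)
  obtain i where i: "[1 + g ^ i = 0] (mod p)"
    using difference_is_power[of 1 0] p_gt_2 by auto
  have "\<not> p dvd 2" using p_gt_2 by (simp add: nat_dvd_not_less)
  have "[g ^ (i + i) + g ^ i = 0] (mod p)"
    using cong_scalar_left[OF i, of "g ^ i"] by (simp add: algebra_simps power_add)
  with i have "[g ^ (i + i) + g ^ i = g ^ 0 + g ^ i] (mod p)" by (simp add: cong_def)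
  then have ii: "[i + i = 0] (mod (p - 1))" unfolding cong_add_rcancel_nat power_cong_iff .
  have "\<not> [i = 0] (mod (p - 1))"
  proof
    assume "[i = 0] (mod (p - 1))"
    then have "[g ^ i = g ^ 0] (mod p)" by (simp only: power_cong_iff)
    then have "[1 + g ^ i = 1 + 1] (mod p)" unfolding cong_add_lcancel_nat by simp
    then have "[2 = 0] (mod p)" using i by (simp add: cong_def numeral_2_eq_2)
    then show False using \<open>\<not> p dvd 2\<close> by (simp add: cong_0_iff)
  qed
  then have ndvd: "\<not> 2 * m dvd i" unfolding cong_0_iff m .
  have "2 * m dvd 2 * i" using ii unfolding cong_0_iff m mult_2 .
  then have "m dvd i" by simp
  then obtain q where iq: "i = m * q" by (rule dvdE)
  have q: "odd q"
  proof
    assume "even q"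
    then obtain r where "q = 2 * r" by (rule evenE)
    then have "i = 2 * m * r" by (simp only: iq mult_ac)
    then show False using ndvd by (metis dvd_triv_left)
  qed
  obtain r where r: "q = 2 * r + 1" using q by (rule oddE)
  have "i = m + 2 * m * r" by (simp add: iq r algebra_simps)
  then have "i = m + (p - 1) * r" by (simp only: m[symmetric])
  then have "[i = m] (mod (p - 1))" by (simp add: cong_def)
  then have "[g ^ i + 1 = g ^ m + 1] (mod p)"
    unfolding cong_add_rcancel_nat power_cong_iff .
  then show ?thesis using i by (simp add: cong_def m_def)
qed

text \<open>
  Reversing an arc changes the sign of the difference of its ends, that is, adds
  \<open>(p - 1) / 2\<close> to the exponent.
\<close>

lemma symmetric_word_graph_iff:
  assumes T: "T \<in> words (p - 1)"
  shows "symmetric (with_proj (word_graph p g T)) \<longleftrightarrow> T \<in> words ((p - 1) div 2)"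
proof -
  let ?m = "(p - 1) div 2" and ?E = "parcs (word_graph p g T)"
  have rev: "[v + g ^ (i + ?m) = u] (mod p)" if "[u + g ^ i = v] (mod p)" for u v i
  proof -
    have "[v + g ^ (i + ?m) = u + g ^ i + g ^ (i + ?m)] (mod p)"
      using that by (simp add: cong_add_rcancel_nat cong_sym)
    also have "u + g ^ i + g ^ (i + ?m) = u + g ^ i * (g ^ ?m + 1)" by (simp add: algebra_simps power_add)
    also have "[\<dots> = u + g ^ i * 0] (mod p)"
      unfolding cong_add_lcancel_nat by (rule cong_scalar_left[OF power_half_cong])
    finally show ?thesis by simp
  qed
  show ?thesis
  proof
    assume sym: "symmetric (with_proj (word_graph p g T))"
    have "T (i + ?m) \<longleftrightarrow> T i" for i
    proof -
      let ?v = "g ^ i mod p"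
      have c: "[0 + g ^ i = ?v] (mod p)" by (simp add: cong_def)
      have lt: "0 < p" "?v < p" using p_gt_2 by simp_all
      have "(0, ?v) \<in> ?E \<longleftrightarrow> (?v, 0) \<in> ?E" using sym by (auto simp: symmetric_def dest: symD)
      then show ?thesis using arc_iff[OF T lt c] arc_iff[OF T lt(2,1) rev[OF c]] by simp
    qed
    then show "T \<in> words ?m" by (simp add: words_iff)
  next
    assume m: "T \<in> words ?m"
    have "(v, u) \<in> ?E" if "(u, v) \<in> ?E" for u v
    proof -
      from that obtain i where i: "u < p" "v < p" "T i" "[u + g ^ i = v] (mod p)"
        by (auto simp: word_graph_def)
      have "T (i + ?m)" using m i by (simp add: words_iff)
      then show ?thesis using arc_iff[OF T i(2,1) rev[OF i(4)]] by simp
    qed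
    then show "symmetric (with_proj (word_graph p g T))" by (auto simp: symmetric_def intro: symI)
  qed
qed

lemma out_degree_word_graph:
  assumes T: "T \<in> words (p - 1)" and u: "u < p"
  shows "out_degree (with_proj (word_graph p g T)) u = weight (p - 1) T"
proof -
  let ?f = "\<lambda>i. (u, (u + g ^ i) mod p)"
  have "out_arcs (with_proj (word_graph p g T)) u = ?f ` {i. i < p - 1 \<and> T i}"
  proof (intro equalityI subsetI)
    fix e assume e: "e \<in> out_arcs (with_proj (word_graph p g T)) u"
    then obtain v i where i: "e = (u, v)" "v < p" "T i" "[u + g ^ i = v] (mod p)"
      by (auto simp: out_arcs_def word_graph_def)
    let ?i = "i mod (p - 1)"
    have c: "[i = ?i] (mod (p - 1))" by (simp add: cong_def)
    then have "[u + g ^ i = u + g ^ ?i] (mod p)" unfolding cong_add_lcancel_nat power_cong_iff .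
    then have "e = ?f ?i" using i by (simp add: cong_def)
    moreover have "T ?i" using words_cong[OF T c] i by simp
    ultimately show "e \<in> ?f ` {i. i < p - 1 \<and> T i}" using p_gt_2 by simp
  qed (use arc_iff_mod[OF T u] in \<open>auto simp: out_arcs_def\<close>)
  moreover have "inj_on ?f {i. i < p - 1 \<and> T i}"
  proof (rule inj_onI)
    fix i j assume ij: "i \<in> {i. i < p - 1 \<and> T i}" "j \<in> {i. i < p - 1 \<and> T i}" "?f i = ?f j"
    then have "[u + g ^ i = u + g ^ j] (mod p)" by (simp add: cong_def)
    then have "[i = j] (mod (p - 1))" unfolding cong_add_lcancel_nat power_cong_iff .
    then show "i = j" using ij by (simp add: cong_less_modulus_unique_nat)
  qed
  ultimately show ?thesis by (simp add: out_degree_def weight_def card_image)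
qed

lemma C_u_even_eq_necklaces:
  defines "m \<equiv> (p - 1) div 2"
  shows "C_u_even p = card (even_words m // orbit_rel shift (even_words m))"
proof -
  have m: "p - 1 = 2 * m" "m > 0" using odd p_gt_2 by (auto simp: m_def)
  have sub: "even_words m \<subseteq> words (p - 1)"
    using words_mono[of m "p - 1"] m(1) by (auto simp: even_words_def)
  have deg: "(\<forall>v\<in>pverts (word_graph p g T). out_degree (with_proj (word_graph p g T)) v mod 4 = 0)
      \<longleftrightarrow> weight (2 * m) T mod 4 = 0" if "T \<in> words (p - 1)" for T
    using out_degree_word_graph[OF that] p_gt_2 m(1) by (auto simp: word_graph_def)
  have "{G. circulant p G \<and> symmetric (with_proj G) \<and>
     (\<forall>v \<in> pverts G. out_degree (with_proj G) v mod 4 = 0)} = word_graph p g ` even_words m" (is "?A = _")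
  proof (intro equalityI subsetI)
    fix G assume G: "G \<in> ?A"
    then obtain T where T: "T \<in> words (p - 1)" "G = word_graph p g T"
      using circulant_is_word_graph by blast
    then have "T \<in> even_words m"
      using G deg[OF T(1)] symmetric_word_graph_iff[OF T(1)] by (simp add: even_words_def m_def)
    then show "G \<in> word_graph p g ` even_words m" using T by blast
  next
    fix G assume "G \<in> word_graph p g ` even_words m"
    then obtain T where T: "T \<in> even_words m" "G = word_graph p g T" by blast
    then have "T \<in> words (p - 1)" using sub by blast
    then show "G \<in> ?A"
      using T deg symmetric_word_graph_iff circulant_word_graph by (simp add: even_words_def m_def)
  qed
  then show ?thesis
    unfolding C_u_even_def
    using num_iso_classes_word_graphs[OF _ sub] cyclic_action_even_words[OF m(2)] m(1) by simp
qed

lemma C_sd_eq_necklaces: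
  "C_sd p = card (sc_words (p - 1) // orbit_rel shift (sc_words (p - 1)))"
proof -
  have sc: "self_complementary (word_graph p g T) \<longleftrightarrow> T \<in> sc_words (p - 1)"
    if T: "T \<in> words (p - 1)" for T
  proof -
    have "self_complementary (word_graph p g T) \<longleftrightarrow> (\<exists>k. T = shift k (- T))"
      unfolding self_complementary_def complement_word_graph[OF T]
      by (rule word_graph_iso_iff[OF T words_compl[OF T]])
    also have "\<dots> \<longleftrightarrow> (\<exists>k. shift k T = - T)"
    proof -
      have "T = shift k (- T) \<longleftrightarrow> shift k T = - T" for k
        by (auto simp: shift_def fun_eq_iff)
      then show ?thesis by simp
    qed
    finally show ?thesis using T by (simp add: sc_words_def)
  qed
  have sub: "sc_words (p - 1) \<subseteq> words (p - 1)" by (auto simp: sc_words_def)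
  have "{G. circulant p G \<and> self_complementary G} = word_graph p g ` sc_words (p - 1)"
    using circulant_is_word_graph circulant_word_graph sc sub by blast
  then show ?thesis
    unfolding C_sd_def
    using num_iso_classes_word_graphs[OF _ sub] cyclic_action_sc_words[of "p - 1"] p_gt_2 by simp
qed

end

theorem mainTheorem10:
  fixes p :: nat
  assumes "prime p" and "odd p"
  shows "C_u_even p = C_sd p"
proof -
  obtain g where "residue_primroot p g"
    using prime_primitive_root_exists[of p] prime_gt_1_nat \<open>prime p\<close> by auto
  then interpret prime_root p g using assms by unfold_locales
  define m where "m = (p - 1) div 2"
  have m: "p - 1 = 2 * m" "m > 0" using odd p_gt_2 by (auto simp: m_def)
  have "C_u_even p = card (even_words m // orbit_rel shift (even_words m))"
    unfolding m_def by (rule C_u_even_eq_necklaces)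
  also have "\<dots> = card (sc_words (2 * m) // orbit_rel shift (sc_words (2 * m)))"
    using m(2) by (rule card_necklaces_eq)
  also have "\<dots> = C_sd p"
    unfolding m(1)[symmetric] by (rule C_sd_eq_necklaces[symmetric])
  finally show ?thesis .
qed

end
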